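(* Let $p\in\mathbb{N}$ be an even integer and let $S\in\mathfrak{L}^c_p(\pi)$. Then for all $(t,a)\in[0,T]\times\mathbb{R}$, $$L^{p,c}_t(a)=\big((S_t-a)^+\big)^{p-1}-\big((S_0-a)^+\big)^{p-1}-\int_0^t\mathbf{1}_{(a,\infty)}(S_u)\,\nabla_p(S_u-a)^+\,dS_u,$$ where the last term denotes the (existing) pointwise limit of compensated Riemann sums $$\int_0^t\mathbf{1}_{(a,\infty)}(S_u)\nabla_p(S_u-a)^+dS_u:=\lim_{n\to\infty}\sum_{\substack{[t_j,t_{j+1}]\in\pi_n\\t_j\le t}}\mathbf{1}_{(a,\infty)}(S_{t_j})\sum_{k=1}^{p-1}\binom{p-1}{k}(S_{t_j}-a)^{p-k-1}(S_{t_{j+1}}-S_{t_j})^k$$ $$=\lim_{n\to\infty}\sum_{\substack{[t_j,t_{j+1}]\in\pi_n\\t_j\le t}}\mathbf{1}_{(a,\infty)}(S_{t_j})\big\{(S_{t_{j+1}}-a)^{p-1}-(S_{t_j}-a)^{p-1}\big\}.$$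
   Context: Fix $T>0$ and a nested sequence $\pi=(\pi_n)_{n\in\mathbb{N}}$ of partitions $\pi_n=\{0=t^n_0<\cdots<t^n_{N(\pi_n)}=T\}$ of $[0,T]$. The notation $[t_j,t_{j+1}]\in\pi_n$ means that $t_j<t_{j+1}$ are consecutive elements of $\pi_n$. For $S\in C([0,T],\mathbb{R})$ put $osc(S,\pi_n):=\max_{[t_j,t_{j+1}]\in\pi_n}\max_{r,s\in[t_j,t_{j+1}]}|S(s)-S(r)|$. Write $S_t=S(t)$ and $x^+=\max(x,0)$. $V_p(\pi)$ is the set of $S\in C([0,T],\mathbb{R})$ with $\lim_n osc(S,\pi_n)=0$ such that the measures $\mu^n:=\sum_{[t_j,t_{j+1}]\in\pi_n}|S(t_{j+1})-S(t_j)|^p\,\delta_{t_j}$ converge vaguely to a $\sigma$-finite measure $\mu$ without atoms; $[S]^p(t):=\mu([0,t])$ is the $p$-th variation of $S$. Continuous local time of order $p$: for an even integer $p$, $\mathfrak{L}^c_p(\pi)$ is the set of $S\in V_p(\pi)$ such that $\lim_n osc(S,\pi_n)=0$ and, for each $t\in[0,T]$, the discrete local times $$x\mapsto L^{\pi_n;p}_t(x):=\sum_{[t_j,t_{j+1}]\in\pi_n,\ t_j\le t}\mathbf{1}_{(\min(S_{t_j},S_{t_{j+1}}),\,\max(S_{t_j},S_{t_{j+1}})]}(x)\,|S_{t_{j+1}}-x|^{p-1},\qquad x\in\mathbb{R},$$ converge uniformly in $x$ as $n\to\infty$ to a limit $x\mapsto L^{p,c}_t(x)$, with $(t,x)\mapsto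 L^{p,c}_t(x)$ jointly continuous on $[0,T]\times\mathbb{R}$. $L^{p,c}$ is called the order $p$ continuous local time of $S$ along $\pi$. *)

theory Defs
  imports "HOL-Analysis.Analysis"
begin

text \<open>A partition \<open>0 = t\<^sub>0 < \<dots> < t\<^sub>N = T\<close> is represented by the finite set of its points. Elements of
  \<open>C([0,T])\<close> are represented by functions \<open>real \<Rightarrow> real\<close> that are continuous on \<open>{0..T}\<close>; only their
  values on \<open>{0..T}\<close> are ever used.\<close>

definition time_partition :: "real \<Rightarrow> real set \<Rightarrow> bool" where
  "time_partition T P \<longleftrightarrow> finite P \<and> P \<subseteq> {0..T} \<and> 0 \<in> P \<and> T \<in> P"

definition nested_partitions :: "real \<Rightarrow> (nat \<Rightarrow> real set) \<Rightarrow> bool" where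
  "nested_partitions T \<pi> \<longleftrightarrow> (\<forall>n. time_partition T (\<pi> n)) \<and> (\<forall>n. \<pi> n \<subseteq> \<pi> (Suc n))"

text \<open>The pairs \<open>(t\<^sub>j, t\<^sub>j\<^sub>+\<^sub>1)\<close> of consecutive points.\<close>

definition partition_intervals :: "real set \<Rightarrow> (real \<times> real) set" where
  "partition_intervals P = {(r, s). r \<in> P \<and> s \<in> P \<and> r < s \<and> P \<inter> {r<..<s} = {}}"

definition intervals_upto :: "real set \<Rightarrow> real \<Rightarrow> (real \<times> real) set" where
  "intervals_upto P t = {(r, s). (r, s) \<in> partition_intervals P \<and> r \<le> t}"

text \<open>The inner maximum over a compact square is written as a supremum; it is attained for
  continuous \<open>S\<close>.\<close>

definition osc :: "(real \<Rightarrow> real) \<Rightarrow> real set \<Rightarrow> real" where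
  "osc S P = (MAX (a, b)\<in>partition_intervals P. SUP (r, s)\<in>{a..b} \<times> {a..b}. \<bar>S s - S r\<bar>)"

text \<open>The measure \<open>\<Sum> \<bar>S(t\<^sub>j\<^sub>+\<^sub>1) - S(t\<^sub>j)\<bar>\<^sup>p \<delta>(t\<^sub>j)\<close> on the Borel sets of \<open>[0,T]\<close>: the image under
  \<open>(t\<^sub>j, t\<^sub>j\<^sub>+\<^sub>1) \<mapsto> t\<^sub>j\<close> of the weighted counting measure on the partition intervals.\<close>

definition variation_measure :: "real \<Rightarrow> nat \<Rightarrow> (real \<Rightarrow> real) \<Rightarrow> real set \<Rightarrow> real measure" where
  "variation_measure T p S P =
     distr (point_measure (partition_intervals P) (\<lambda>(r, s). ennreal (\<bar>S s - S r\<bar> ^ p)))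
       (restrict_space borel {0..T}) fst"

text \<open>Vague convergence of Borel measures on \<open>X\<close>, tested on \<open>C\<^sub>c(X)\<close>. Integrability with respect to
  the limit is demanded explicitly because the Bochner integral of a non-integrable function is \<open>0\<close>.\<close>

definition vague_conv_on :: "real set \<Rightarrow> (nat \<Rightarrow> real measure) \<Rightarrow> real measure \<Rightarrow> bool" where
  "vague_conv_on X M \<mu> \<longleftrightarrow>
     (\<forall>f :: real \<Rightarrow> real. continuous_on X f \<and> (\<exists>K\<subseteq>X. compact K \<and> (\<forall>x\<in>X - K. f x = 0)) \<longrightarrow>
        integrable \<mu> f \<and> (\<lambda>n. integral\<^sup>L (M n) f) \<longlonglongrightarrow> integral\<^sup>L \<mu> f)"

definition V :: "real \<Rightarrow> (nat \<Rightarrow> real set) \<Rightarrow> nat \<Rightarrow> (real \<Rightarrow> real) set" where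
  "V T \<pi> p = {S. continuous_on {0..T} S \<and> (\<lambda>n. osc S (\<pi> n)) \<longlonglongrightarrow> 0 \<and>
     (\<exists>\<mu>. sets \<mu> = sets (restrict_space borel {0..T}) \<and> sigma_finite_measure \<mu> \<and>
        (\<forall>t\<in>{0..T}. emeasure \<mu> {t} = 0) \<and>
        vague_conv_on {0..T} (\<lambda>n. variation_measure T p S (\<pi> n)) \<mu>)}"

definition discrete_local_time :: "real set \<Rightarrow> nat \<Rightarrow> (real \<Rightarrow> real) \<Rightarrow> real \<Rightarrow> real \<Rightarrow> real" where
  "discrete_local_time P p S t x =
     (\<Sum>(r, s)\<in>intervals_upto P t.
        indicat_real {min (S r) (S s)<..max (S r) (S s)} x * \<bar>S s - x\<bar> ^ (p - 1))"

definition local_time :: "(nat \<Rightarrow> real set) \<Rightarrow> nat \<Rightarrow> (real \<Rightarrow> real) \<Rightarrow> real \<Rightarrow> real \<Rightarrow> real" where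
  "local_time \<pi> p S t x = lim (\<lambda>n. discrete_local_time (\<pi> n) p S t x)"

text \<open>Paths with a continuous local time of order \<open>p\<close>, for even \<open>p > 0\<close>. Then \<^const>\<open>local_time\<close>
  is the unique (uniform) limit of the discrete local times.\<close>

definition Lc :: "real \<Rightarrow> (nat \<Rightarrow> real set) \<Rightarrow> nat \<Rightarrow> (real \<Rightarrow> real) set" where
  "Lc T \<pi> p = {S \<in> V T \<pi> p. (\<lambda>n. osc S (\<pi> n)) \<longlonglongrightarrow> 0 \<and>
     (\<forall>t\<in>{0..T}. uniform_limit UNIV (\<lambda>n x. discrete_local_time (\<pi> n) p S t x)
        (local_time \<pi> p S t) sequentially) \<and>
     continuous_on ({0..T} \<times> UNIV) (\<lambda>(t, x). local_time \<pi> p S t x)}"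

definition compensated_sum :: "real set \<Rightarrow> nat \<Rightarrow> (real \<Rightarrow> real) \<Rightarrow> real \<Rightarrow> real \<Rightarrow> real" where
  "compensated_sum P p S a t =
     (\<Sum>(r, s)\<in>intervals_upto P t. indicat_real {a<..} (S r) *
        (\<Sum>k = 1..p - 1. real ((p - 1) choose k) * (S r - a) ^ (p - k - 1) * (S s - S r) ^ k))"

text \<open>The integral \<open>\<integral>\<^sub>0\<^sup>t 1\<^bsub>(a,\<infinity>)\<^esub>(S\<^sub>u) \<nabla>\<^sub>p(S\<^sub>u - a)\<^sup>+ dS\<^sub>u\<close>; only meaningful where the limit exists.\<close>

definition follmer_integral :: "(nat \<Rightarrow> real set) \<Rightarrow> nat \<Rightarrow> (real \<Rightarrow> real) \<Rightarrow> real \<Rightarrow> real \<Rightarrow> real" where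
  "follmer_integral \<pi> p S a t = lim (\<lambda>n. compensated_sum (\<pi> n) p S a t)"

end

theory Submission
  imports Defs
begin

text \<open>Put \<open>q = p - 1\<close>, an odd number, and let \<open>F x = ((x - a)\<^sup>+)\<^sup>q\<close>. Over one partition interval, on
  which \<open>S\<close> moves from \<open>x\<close> to \<open>y\<close>, the increment \<open>F y - F x\<close> is the compensated summand
  \<open>1\<^bsub>(a,\<infinity>)\<^esub>(x) ((y - a)\<^sup>q - (x - a)\<^sup>q)\<close> plus a remainder, which vanishes unless exactly one
  of \<open>x\<close> and \<open>y\<close> exceeds \<open>a\<close> and is then \<open>\<bar>y - a\<bar>\<^sup>q\<close>, because \<open>q\<close> is odd
  (\<open>pos_part_power_increment\<close>). The increments telescope to \<open>F (S u) - F (S 0)\<close>, where \<open>u\<close> is the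
  right end of a partition interval containing \<open>t\<close>, and this tends to \<open>F (S t) - F (S 0)\<close> since the
  oscillation vanishes. So the compensated sums converge as soon as the summed remainders do.

  The summed remainder is almost the discrete local time, but not quite: it counts the crossings with
  \<open>a \<in> [min x y, max x y)\<close>, whereas the discrete local time uses \<open>(min x y, max x y]\<close>. The two differ
  by the terms that start exactly at the level \<open>a\<close> (those ending there contribute \<open>0\<^sup>q = 0\<close>). A path
  may sit at \<open>a\<close> at many partition points, so vanishing oscillation alone does not bound their sum.
  What does is the kind of convergence assumed of the local times: the summed remainder is the right limit at \<open>a\<close> of the
  discrete local time (\<open>discrete_local_time_right_limit\<close>), and uniform convergence to a continuous
  function forces the right limits to converge to the same value (\<open>right_limits_converge\<close>).\<close>

section \<open>Sums over partitions\<close>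

lemma finite_partition_intervals: "finite P \<Longrightarrow> finite (partition_intervals P)"
  by (rule finite_subset[of _ "P \<times> P"]) (auto simp: partition_intervals_def)

lemma finite_intervals_upto: "finite P \<Longrightarrow> finite (intervals_upto P t)"
  by (rule finite_subset[OF _ finite_partition_intervals]) (auto simp: intervals_upto_def)

lemma partition_intervals_insert_greater:
  assumes "finite A" "A \<noteq> {}" "\<forall>x\<in>A. x < b"
  shows "partition_intervals (insert b A) = insert (Max A, b) (partition_intervals A)"
proof (rule set_eqI, safe)
  fix r s assume rs: "(r, s) \<in> partition_intervals (insert b A)" "(r, s) \<notin> partition_intervals A"
  have "s = b \<and> r \<in> A"
    using rs assms(3) by (force simp: partition_intervals_def)
  moreover from this have "Max A \<le> r"
    using rs(1) assms by (intro Max.boundedI) (force simp: partition_intervals_def)+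
  ultimately show "r = Max A" "s = b"
    using Max_ge[OF assms(1), of r] by auto
next
  show "(Max A, b) \<in> partition_intervals (insert b A)"
    using assms by (auto simp: partition_intervals_def not_less dest: Max_ge)
next
  fix r s assume "(r, s) \<in> partition_intervals A"
  then show "(r, s) \<in> partition_intervals (insert b A)"
    using assms(3) by (force simp: partition_intervals_def)
qed

lemma sum_partition_intervals_telescope:
  fixes f :: "real \<Rightarrow> real"
  assumes "finite P" "P \<noteq> {}"
  shows "(\<Sum>(r, s)\<in>partition_intervals P. f s - f r) = f (Max P) - f (Min P)"
  using assms
proof (induction rule: finite_linorder_max_induct)
  case (insert b A)
  show ?case
  proof (cases "A = {}")
    case True
    then show ?thesis by (simp add: partition_intervals_def case_prod_unfold)
  next
    case False
    have "Max (insert b A) = b"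
      using insert.hyps by (intro Max_eqI) auto
    moreover have "Min A < b"
      using insert.hyps False by simp
    then have "Min (insert b A) = Min A"
      using insert.hyps False by simp
    moreover have "(Max A, b) \<notin> partition_intervals A"
      using insert.hyps by (auto simp: partition_intervals_def)
    ultimately show ?thesis
      using insert.IH[OF False] insert.hyps False
      by (simp add: partition_intervals_insert_greater finite_partition_intervals)
  qed
qed simp

text \<open>The intervals counted up to \<open>t\<close> are those of the partition cut off at \<open>u\<close>, so that their sum
  telescopes. At \<open>t = T\<close> there is no point of the partition beyond \<open>t\<close>; the containing
  interval is then the last one, with \<open>u = T\<close>, and all the intervals are counted.\<close>

lemma partition_interval_containing:
  assumes P: "time_partition T P" and T: "T > 0" and t: "t \<in> {0..T}"
  obtains r u where "(r, u) \<in> partition_intervals P" "r \<le> t" "t \<le> u"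
    "intervals_upto P t = partition_intervals (P \<inter> {..u})"
proof -
  have fin: "finite P" and P0: "0 \<in> P" and PT: "T \<in> P" and sub: "P \<subseteq> {0..T}"
    using P by (auto simp: time_partition_def)
  show ?thesis
  proof (cases "t < T")
    case True
    define r where "r = Max {x\<in>P. x \<le> t}"
    define u where "u = Min {x\<in>P. t < x}"
    have "r \<in> {x\<in>P. x \<le> t}" unfolding r_def
      using fin P0 t by (intro Max_in) auto
    moreover have r_max: "x \<le> r" if "x \<in> P" "x \<le> t" for x
      unfolding r_def using fin that by auto
    moreover have "u \<in> {x\<in>P. t < x}" unfolding u_def
      using fin PT True by (intro Min_in) auto
    moreover have u_min: "u \<le> x" if "x \<in> P" "t < x" for x
      unfolding u_def using fin that by auto
    ultimately have ru: "r \<in> P" "r \<le> t" "u \<in> P" "t < u" by auto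
    have "(r, u) \<in> partition_intervals P"
      using ru r_max u_min by (force simp: partition_intervals_def)
    moreover have "intervals_upto P t = partition_intervals (P \<inter> {..u})"
      using ru u_min by (force simp: partition_intervals_def intervals_upto_def)
    ultimately show ?thesis using that ru by simp
  next
    case False
    define r where "r = Max {x\<in>P. x < T}"
    have "r \<in> {x\<in>P. x < T}" unfolding r_def
      using fin P0 T by (intro Max_in) auto
    moreover have r_max: "x \<le> r" if "x \<in> P" "x < T" for x
      unfolding r_def using fin that by auto
    ultimately have r: "(r, T) \<in> partition_intervals P" "r \<le> t"
      using PT False t by (force simp: partition_intervals_def)+
    have "P \<inter> {..T} = P" using sub by auto
    moreover have "intervals_upto P t = partition_intervals P"
      using sub False t by (force simp: intervals_upto_def partition_intervals_def)
    ultimately show ?thesis using that[OF r] t by simp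
  qed
qed

lemma increment_le_osc:
  assumes S: "continuous_on {0..T} S" and P: "time_partition T P"
    and ab: "(a, b) \<in> partition_intervals P" and rs: "r \<in> {a..b}" "s \<in> {a..b}"
  shows "\<bar>S s - S r\<bar> \<le> osc S P"
proof -
  let ?f = "\<lambda>(r, s). \<bar>S s - S r\<bar>"
  have "{a..b} \<subseteq> {0..T}"
    using P ab by (auto simp: time_partition_def partition_intervals_def)
  then have "continuous_on {a..b} S" using S continuous_on_subset by blast
  then have "continuous_on ({a..b} \<times> {a..b}) ?f"
    unfolding case_prod_unfold
    by (intro continuous_on_rabs continuous_on_diff
          continuous_on_compose2[of "{a..b}" S _ fst] continuous_on_compose2[of "{a..b}" S _ snd]
          continuous_on_fst continuous_on_snd continuous_on_id) auto
  then have "compact (?f ` ({a..b} \<times> {a..b}))"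
    by (intro compact_continuous_image compact_Times compact_Icc)
  then have "bdd_above (?f ` ({a..b} \<times> {a..b}))"
    by (intro bounded_imp_bdd_above compact_imp_bounded)
  then have "?f (r, s) \<le> (SUP x\<in>{a..b} \<times> {a..b}. ?f x)"
    using rs by (intro cSUP_upper) auto
  also have "\<dots> \<le> osc S P"
  proof -
    have "finite (partition_intervals P)"
      using P by (simp add: time_partition_def finite_partition_intervals)
    from Max_ge[OF finite_imageI[OF this] imageI[OF ab],
        of "\<lambda>(a, b). SUP (r, s)\<in>{a..b} \<times> {a..b}. \<bar>S s - S r\<bar>"]
    show ?thesis unfolding osc_def by simp
  qed
  finally show ?thesis by simp
qed

text \<open>The sum telescopes to \<open>F (S u) - F (S 0)\<close>, where \<open>u\<close> is a partition point that may overshoot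
  \<open>t\<close>. Since \<open>t\<close> and \<open>u\<close> lie in one partition interval, replacing \<open>S u\<close> by \<open>S t\<close> costs at most the
  oscillation.\<close>

lemma telescoped_increments_converge:
  fixes F :: "real \<Rightarrow> real"
  assumes T: "T > 0" and P: "\<And>n. time_partition T (\<pi> n)" and S: "continuous_on {0..T} S"
    and osc: "(\<lambda>n. osc S (\<pi> n)) \<longlonglongrightarrow> 0" and F: "isCont F (S t)" and t: "t \<in> {0..T}"
  shows "(\<lambda>n. \<Sum>(r, s)\<in>intervals_upto (\<pi> n) t. F (S s) - F (S r)) \<longlonglongrightarrow> F (S t) - F (S 0)"
proof -
  have "\<exists>u. \<bar>S u - S t\<bar> \<le> osc S (\<pi> n) \<and>
      (\<Sum>(r, s)\<in>intervals_upto (\<pi> n) t. F (S s) - F (S r)) = F (S u) - F (S 0)" for n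
  proof -
    obtain r u where ru: "(r, u) \<in> partition_intervals (\<pi> n)" "r \<le> t" "t \<le> u"
      "intervals_upto (\<pi> n) t = partition_intervals (\<pi> n \<inter> {..u})"
      by (rule partition_interval_containing[OF P T t])
    have Pn: "finite (\<pi> n)" "0 \<in> \<pi> n" "\<pi> n \<subseteq> {0..T}" "u \<in> \<pi> n"
      using P[of n] ru(1) by (auto simp: time_partition_def partition_intervals_def)
    then have u: "0 \<le> u" by auto
    have ends: "Max (\<pi> n \<inter> {..u}) = u" "Min (\<pi> n \<inter> {..u}) = 0"
      using Pn u by (auto intro!: Max_eqI Min_eqI)
    have "(\<Sum>(r, s)\<in>partition_intervals (\<pi> n \<inter> {..u}). F (S s) - F (S r))
        = F (S (Max (\<pi> n \<inter> {..u}))) - F (S (Min (\<pi> n \<inter> {..u})))"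
      by (rule sum_partition_intervals_telescope[of _ "\<lambda>x. F (S x)"]) (use Pn in auto)
    then have "(\<Sum>(r, s)\<in>intervals_upto (\<pi> n) t. F (S s) - F (S r)) = F (S u) - F (S 0)"
      unfolding ru(4) ends .
    moreover have "\<bar>S u - S t\<bar> \<le> osc S (\<pi> n)"
      using ru(2,3) by (intro increment_le_osc[OF S P ru(1)]) simp_all
    ultimately show ?thesis by blast
  qed
  then have "\<forall>n. \<exists>u. \<bar>S u - S t\<bar> \<le> osc S (\<pi> n) \<and>
      (\<Sum>(r, s)\<in>intervals_upto (\<pi> n) t. F (S s) - F (S r)) = F (S u) - F (S 0)" ..
  from choice[OF this] obtain u where u: "\<And>n. \<bar>S (u n) - S t\<bar> \<le> osc S (\<pi> n)"
      "\<And>n. (\<Sum>(r, s)\<in>intervals_upto (\<pi> n) t. F (S s) - F (S r)) = F (S (u n)) - F (S 0)"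
    by blast
  have "(\<lambda>n. S (u n) - S t) \<longlonglongrightarrow> 0"
    by (rule Lim_null_comparison[OF _ osc]) (simp add: u(1))
  then have "(\<lambda>n. F (S (u n))) \<longlonglongrightarrow> F (S t)"
    by (rule isCont_tendsto_compose[OF F LIM_zero_cancel])
  then show ?thesis unfolding u(2) by (intro tendsto_intros)
qed

section \<open>Crossings of a level\<close>

text \<open>If \<open>y \<le> a < x\<close>, the left side is \<open>- (x - a)\<^sup>q\<close>, so the remainder is \<open>- (y - a)\<^sup>q\<close>; this is
  \<open>\<bar>y - a\<bar>\<^sup>q\<close> exactly because \<open>q\<close> is odd. The strict inequality in \<open>a < x\<close> is what forces the interval
  to be closed on the left: for \<open>x = a < y\<close> the whole increment \<open>(y - a)\<^sup>q\<close> is remainder, and for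
  \<open>y < x = a\<close> there is none.\<close>

lemma pos_part_power_increment:
  fixes a x y :: real
  assumes "odd q"
  shows "max (y - a) 0 ^ q - max (x - a) 0 ^ q
    = indicat_real {a<..} x * ((y - a) ^ q - (x - a) ^ q)
      + indicat_real {min x y..<max x y} a * \<bar>y - a\<bar> ^ q"
proof -
  have "0 ^ q = (0 :: real)" using assms by (cases q) auto
  moreover have "(a - y) ^ q = - ((y - a) ^ q)"
    using power_minus_odd[OF assms, of "y - a"] by simp
  ultimately show ?thesis
    by (cases "x > a"; cases "y > a") (auto simp: indicator_def max_def min_def abs_if)
qed

text \<open>Only the half-open intervals matter: for \<open>x\<close> slightly to the right of \<open>a\<close>, \<open>x\<close> lies in \<open>(m, M]\<close>
  exactly when \<open>a\<close> lies in \<open>[m, M)\<close>.\<close>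

lemma discrete_local_time_right_limit:
  assumes "finite P"
  shows "((\<lambda>x. discrete_local_time P p S t x) \<longlongrightarrow>
    (\<Sum>(r, s)\<in>intervals_upto P t.
       indicat_real {min (S r) (S s)..<max (S r) (S s)} a * \<bar>S s - a\<bar> ^ (p - 1))) (at_right a)"
proof -
  have ind: "((\<lambda>x. indicat_real {m<..M} x) \<longlongrightarrow> indicat_real {m..<M} a) (at_right a)" for m M :: real
  proof (rule tendsto_eventually)
    consider "a < m" | "M \<le> a" | "m \<le> a" "a < M" by linarith
    then show "\<forall>\<^sub>F x in at_right a. indicat_real {m<..M} x = indicat_real {m..<M} a"
    proof cases
      case 1
      have "\<forall>\<^sub>F x in at_right a. x \<in> {a<..<m}" using 1 by (rule eventually_at_right_real)
      then show ?thesis by eventually_elim (use 1 in \<open>auto simp: indicator_def\<close>)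
    next
      case 2
      have "\<forall>\<^sub>F x in at_right a. x > a" by (rule eventually_at_right_less)
      then show ?thesis by eventually_elim (use 2 in \<open>auto simp: indicator_def\<close>)
    next
      case 3
      have "\<forall>\<^sub>F x in at_right a. x \<in> {a<..<M}" using 3 by (intro eventually_at_right_real)
      then show ?thesis by eventually_elim (use 3 in \<open>auto simp: indicator_def\<close>)
    qed
  qed
  show ?thesis
    unfolding discrete_local_time_def case_prod_unfold
    by (intro tendsto_intros ind)
qed

text \<open>A bound \<open>\<bar>f n x - g x\<bar> < \<epsilon>\<close> that is uniform in \<open>x\<close> survives the passage \<open>x \<rightarrow> a\<^sup>+\<close>. Pointwise
  convergence would not be enough: the jump of \<open>f n\<close> at \<open>a\<close> could stay bounded away from \<open>0\<close>.\<close>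

lemma right_limits_converge:
  fixes f :: "nat \<Rightarrow> real \<Rightarrow> real"
  assumes unif: "uniform_limit UNIV f g sequentially" and g: "isCont g a"
    and lim: "\<And>n. (f n \<longlongrightarrow> h n) (at_right a)"
  shows "h \<longlonglongrightarrow> g a"
proof (rule tendstoI)
  fix e :: real assume e: "e > 0"
  have "\<forall>\<^sub>F n in sequentially. \<forall>x\<in>UNIV. dist (f n x) (g x) < e / 2"
    using unif e by (intro uniform_limitD) auto
  then show "\<forall>\<^sub>F n in sequentially. dist (h n) (g a) < e"
  proof eventually_elim
    case (elim n)
    have "(g \<longlongrightarrow> g a) (at_right a)"
      using g unfolding isCont_def by (rule filterlim_mono) (auto intro: at_le)
    then have "((\<lambda>x. dist (f n x) (g x)) \<longlongrightarrow> dist (h n) (g a)) (at_right a)"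
      by (intro tendsto_dist lim)
    then have "dist (h n) (g a) \<le> e / 2"
      by (rule tendsto_upperbound) (use elim in \<open>auto intro!: always_eventually less_imp_le\<close>)
    then show ?case using e by linarith
  qed
qed

section \<open>The Tanaka formula\<close>

text \<open>By the binomial theorem: the compensated summand leaves out just the term \<open>k = 0\<close>.\<close>

lemma compensated_sum_eq_power_increments:
  assumes "p > 0"
  shows "compensated_sum P p S a t = (\<Sum>(r, s)\<in>intervals_upto P t.
    indicat_real {a<..} (S r) * ((S s - a) ^ (p - 1) - (S r - a) ^ (p - 1)))"
proof -
  have "(\<Sum>k = 1..p - 1. real ((p - 1) choose k) * x ^ (p - k - 1) * d ^ k)
      = (x + d) ^ (p - 1) - x ^ (p - 1)" for x d :: real
  proof -
    have "(x + d) ^ (p - 1) = (\<Sum>k\<le>p - 1. real ((p - 1) choose k) * d ^ k * x ^ (p - 1 - k))"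
      using binomial_ring[of d x "p - 1"] by (simp add: add.commute)
    also have "{..p - 1} = insert 0 {1..p - 1}" by auto
    finally show ?thesis by (simp add: mult.assoc mult.commute[of "d ^ _"])
  qed
  from this[of "S r - a" "S s - S r" for r s]
  show ?thesis unfolding compensated_sum_def by simp
qed

theorem corollary3p6:
  fixes T :: real and \<pi> :: "nat \<Rightarrow> real set" and p :: nat and S :: "real \<Rightarrow> real"
  assumes "T > 0" and "nested_partitions T \<pi>"
    and "even p" and "p > 0"
    and "S \<in> Lc T \<pi> p"
  shows "\<forall>t\<in>{0..T}. \<forall>a.
    convergent (\<lambda>n. compensated_sum (\<pi> n) p S a t) \<and>
    (\<lambda>n. \<Sum>(r, s)\<in>intervals_upto (\<pi> n) t.
        indicat_real {a<..} (S r) * ((S s - a) ^ (p - 1) - (S r - a) ^ (p - 1)))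
      \<longlonglongrightarrow> follmer_integral \<pi> p S a t \<and>
    local_time \<pi> p S t a =
      (max (S t - a) 0) ^ (p - 1) - (max (S 0 - a) 0) ^ (p - 1) - follmer_integral \<pi> p S a t"
proof (intro ballI allI)
  fix t a :: real assume t: "t \<in> {0..T}"
  have P: "time_partition T (\<pi> n)" for n
    using assms(2) by (simp add: nested_partitions_def)
  have S: "continuous_on {0..T} S" and osc: "(\<lambda>n. osc S (\<pi> n)) \<longlonglongrightarrow> 0"
    and unif: "uniform_limit UNIV (\<lambda>n x. discrete_local_time (\<pi> n) p S t x)
        (local_time \<pi> p S t) sequentially"
    and joint: "continuous_on ({0..T} \<times> UNIV) (\<lambda>(t, x). local_time \<pi> p S t x)"
    using assms(5) t by (auto simp: Lc_def V_def)
  have "continuous_on UNIV (\<lambda>x. case (t, x) of (t, x) \<Rightarrow> local_time \<pi> p S t x)"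
    by (rule continuous_on_compose2[OF joint]) (use t in \<open>auto intro!: continuous_intros\<close>)
  then have cont: "isCont (local_time \<pi> p S t) a"
    by (simp add: continuous_on_eq_continuous_at)

  let ?F = "\<lambda>x. max (x - a) 0 ^ (p - 1)"
  let ?R = "\<lambda>n. \<Sum>(r, s)\<in>intervals_upto (\<pi> n) t.
       indicat_real {min (S r) (S s)..<max (S r) (S s)} a * \<bar>S s - a\<bar> ^ (p - 1)"
  have odd: "odd (p - 1)" using assms(3,4) by simp
  have R: "?R \<longlonglongrightarrow> local_time \<pi> p S t a"
    by (rule right_limits_converge[OF unif cont discrete_local_time_right_limit])
       (use P in \<open>simp add: time_partition_def\<close>)
  have tele: "(\<lambda>n. \<Sum>(r, s)\<in>intervals_upto (\<pi> n) t. ?F (S s) - ?F (S r)) \<longlonglongrightarrow> ?F (S t) - ?F (S 0)"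
    by (rule telescoped_increments_converge[OF assms(1) P S osc _ t]) (auto intro!: continuous_intros)
  have "compensated_sum (\<pi> n) p S a t
      = (\<Sum>(r, s)\<in>intervals_upto (\<pi> n) t. ?F (S s) - ?F (S r)) - ?R n" for n
    unfolding compensated_sum_eq_power_increments[OF assms(4)] pos_part_power_increment[OF odd]
    by (simp add: case_prod_unfold sum.distrib)
  with tendsto_diff[OF tele R]
  have lim: "(\<lambda>n. compensated_sum (\<pi> n) p S a t)
      \<longlonglongrightarrow> ?F (S t) - ?F (S 0) - local_time \<pi> p S t a"
    by simp
  then have "follmer_integral \<pi> p S a t = ?F (S t) - ?F (S 0) - local_time \<pi> p S t a"
    unfolding follmer_integral_def by (rule limI)
  then show "convergent (\<lambda>n. compensated_sum (\<pi> n) p S a t) \<and>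
    (\<lambda>n. \<Sum>(r, s)\<in>intervals_upto (\<pi> n) t.
        indicat_real {a<..} (S r) * ((S s - a) ^ (p - 1) - (S r - a) ^ (p - 1)))
      \<longlonglongrightarrow> follmer_integral \<pi> p S a t \<and>
    local_time \<pi> p S t a =
      (max (S t - a) 0) ^ (p - 1) - (max (S 0 - a) 0) ^ (p - 1) - follmer_integral \<pi> p S a t"
    using lim by (auto simp: convergent_def compensated_sum_eq_power_increments[OF assms(4)])
qed

end
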